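(* Let $\mathcal{A}\in\mathbb{C}^{n\times n\times p}$ be a complex tensor with T-index $1$. Let the T-Jordan canonical form of $\mathcal{A}$ be $$\mathcal{A}=\mathcal{P}^{-1}*\mathcal{J}*\mathcal{P},$$ where $\mathcal{P}\in\mathbb{C}^{n\times n\times p}$ is an invertible tensor and $\mathcal{J}\in\mathbb{C}^{n\times n\times p}$ is the Jordan canonical form of $\mathcal{A}$. Then $$\mathcal{A}^{\#}=\mathcal{P}^{-1}*\mathcal{J}^{\#}*\mathcal{P},$$ where $\mathcal{J}^{\#}$ is the T-group inverse of $\mathcal{J}$.
   Context: For $\mathcal{A}\in\mathbb{C}^{m\times n\times p}$ let $A^{(1)},\dots,A^{(p)}\in\mathbb{C}^{m\times n}$ be its frontal slices. $\mathrm{bcirc}(\mathcal{A})$ is the $mp\times np$ block circulant matrix whose $(i,j)$ block ($1\le i,j\le p$) is $A^{(((i-j)\bmod p)+1)}$; $\mathrm{unfold}(\mathcal{A})$ is the $mp\times n$ matrix obtained by stacking $A^{(1)},\dots,A^{(p)}$ vertically, and $\mathrm{fold}$ is the inverse of $\mathrm{unfold}$. The T-product is $\mathcal{A}*\mathcal{B}=\mathrm{fold}(\mathrm{bcirc}(\mathcal{A})\,\mathrm{unfold}(\mathcal{B}))$. The identity tensor $\mathcal{I}$ has first frontal slice $I_n$ and other slices zero; $\mathcal{P}^{-1}$ is the inverse with respect to $*$ and $\mathcal{I}$. The index $\mathrm{Ind}(A)$ of a square matrix $A$ is the smallest positive integer $k$ with $\mathrm{rank}(A^k)=\mathrm{rank}(A^{k+1})$,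 and the T-index is $\mathrm{Ind}_T(\mathcal{A})=\mathrm{Ind}(\mathrm{bcirc}(\mathcal{A}))$. The T-group inverse $\mathcal{A}^{\#}$ is the unique tensor $\mathcal{X}\in\mathbb{C}^{n\times n\times p}$ (when it exists) with $\mathcal{A}*\mathcal{X}*\mathcal{A}=\mathcal{A}$, $\mathcal{X}*\mathcal{A}*\mathcal{X}=\mathcal{X}$, $\mathcal{A}*\mathcal{X}=\mathcal{X}*\mathcal{A}$. T-Jordan canonical form: let $F_p$ be the unitary $p\times p$ discrete Fourier matrix with entries $\frac1{\sqrt p}\omega^{(j-1)(k-1)}$, $\omega=e^{-2\pi\mathbf{i}/p}$; write $\mathrm{bcirc}(\mathcal{A})=(F_p\otimes I_n)\mathrm{diag}(B^{(1)},\dots,B^{(p)})(F_p^H\otimes I_n)$ and $B^{(i)}=(P^{(i)})^{-1}C^{(i)}P^{(i)}$ with $C^{(i)}$ the Jordan canonical form of $B^{(i)}$; then $\mathcal{P},\mathcal{J}$ are defined by $\mathrm{bcirc}(\mathcal{P})=(F_p\otimes I_n)\mathrm{diag}(P^{(1)},\dots,P^{(p)})(F_p^H\otimes I_n)$ and $\mathrm{bcirc}(\mathcal{J})=(F_p\otimes I_n)\mathrm{diag}(C^{(1)},\dots,C^{(p)})(F_p^H\otimes I_n)$, so that $\mathcal{A}=\mathcal{P}^{-1}*\mathcal{J}*\mathcal{P}$. *)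

theory Defs
  imports
    Complex_Main
    "Jordan_Normal_Form.Matrix"
    "Jordan_Normal_Form.DL_Rank"
    "Jordan_Normal_Form.Schur_Decomposition"
    "Jordan_Normal_Form.Jordan_Normal_Form"
begin

text \<open>A third-order tensor of size \<open>m \<times> n \<times> p\<close> is the list of its \<open>p\<close> frontal slices.
  All indices are 0-based, so that \<open>T ! k\<close> is the slice written \<open>T\<^sup>(\<^sup>k\<^sup>+\<^sup>1\<^sup>)\<close>
  with 1-based indices.\<close>

type_synonym tensor = "complex mat list"

definition carrier_tensor :: "nat \<Rightarrow> nat \<Rightarrow> nat \<Rightarrow> tensor set" where
  "carrier_tensor m n p = {T. length T = p \<and> set T \<subseteq> carrier_mat m n}"

text \<open>The slice dimensions are read off the first slice and are meaningful only when there is one.\<close>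

definition t_rows :: "tensor \<Rightarrow> nat" where
  "t_rows T = dim_row (T ! 0)"

definition t_cols :: "tensor \<Rightarrow> nat" where
  "t_cols T = dim_col (T ! 0)"

text \<open>The summand \<open>length T\<close> only prevents truncation of the subtraction: block \<open>(a, b)\<close> is slice
  \<open>(a - b) mod p\<close>.\<close>

definition bcirc :: "tensor \<Rightarrow> complex mat" where
  "bcirc T = mat (length T * t_rows T) (length T * t_cols T)
     (\<lambda>(i, j). (T ! ((length T + i div t_rows T - j div t_cols T) mod length T))
                 $$ (i mod t_rows T, j mod t_cols T))"

definition t_unfold :: "tensor \<Rightarrow> complex mat" where
  "t_unfold T = mat (length T * t_rows T) (t_cols T)
     (\<lambda>(i, j). (T ! (i div t_rows T)) $$ (i mod t_rows T, j))"

definition t_fold :: "nat \<Rightarrow> nat \<Rightarrow> complex mat \<Rightarrow> tensor" where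
  "t_fold m p M = map (\<lambda>k. mat m (dim_col M) (\<lambda>(i, j). M $$ (k * m + i, j))) [0..<p]"

lemma nth_carrier_tensor:
  assumes "T \<in> carrier_tensor m n p" "k < p"
  shows "T ! k \<in> carrier_mat m n"
  using assms nth_mem[of k T] unfolding carrier_tensor_def by blast

lemma t_dims:
  assumes "T \<in> carrier_tensor m n p" "0 < p"
  shows "length T = p" "t_rows T = m" "t_cols T = n"
  using assms nth_carrier_tensor[OF assms]
  by (auto simp: carrier_tensor_def t_rows_def t_cols_def)

lemma block_index_less: "k < p \<Longrightarrow> i < m \<Longrightarrow> k * m + i < p * (m::nat)"
  using mult_le_mono1[of "Suc k" p m] by simp

lemma t_fold_unfold:
  assumes "T \<in> carrier_tensor m n p" "0 < p"
  shows "t_fold m p (t_unfold T) = T"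
proof (rule nth_equalityI)
  show "length (t_fold m p (t_unfold T)) = length T"
    using t_dims[OF assms] by (simp add: t_fold_def)
  fix k assume "k < length (t_fold m p (t_unfold T))"
  then have k: "k < p" by (simp add: t_fold_def)
  show "t_fold m p (t_unfold T) ! k = T ! k"
    using k t_dims[OF assms] nth_carrier_tensor[OF assms(1) k]
    by (intro eq_matI) (auto simp: t_fold_def t_unfold_def block_index_less)
qed

lemma t_unfold_fold:
  assumes "M \<in> carrier_mat (p * m) n" "0 < p"
  shows "t_fold m p M \<in> carrier_tensor m n p" "t_unfold (t_fold m p M) = M"
proof -
  show c: "t_fold m p M \<in> carrier_tensor m n p"
    using assms(1) by (auto simp: carrier_tensor_def t_fold_def)
  show "t_unfold (t_fold m p M) = M"
  proof (rule eq_matI)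
    fix i j assume ij: "i < dim_row M" "j < dim_col M"
    then have i: "i < p * m" and "0 < m" using assms(1) by (auto intro: Nat.gr0I)
    then have "i div m < p" "i mod m < m" by (simp_all add: less_mult_imp_div_less)
    then show "t_unfold (t_fold m p M) $$ (i, j) = M $$ (i, j)"
      using i ij t_dims[OF c assms(2)] assms(1)
      by (auto simp: t_unfold_def t_fold_def)
  qed (use t_dims[OF c assms(2)] assms(1) in \<open>auto simp: t_unfold_def\<close>)
qed

definition t_mult :: "tensor \<Rightarrow> tensor \<Rightarrow> tensor" (infixl \<open>*\<^sub>t\<close> 70) where
  "S *\<^sub>t T = t_fold (t_rows S) (length S) (bcirc S * t_unfold T)"

definition t_one :: "nat \<Rightarrow> nat \<Rightarrow> tensor" where
  "t_one n p = map (\<lambda>k. if k = 0 then 1\<^sub>m n else 0\<^sub>m n n) [0..<p]"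

definition is_t_inverse :: "tensor \<Rightarrow> tensor \<Rightarrow> bool" where
  "is_t_inverse T X \<longleftrightarrow>
     X \<in> carrier_tensor (t_rows T) (t_rows T) (length T) \<and>
     T *\<^sub>t X = t_one (t_rows T) (length T) \<and> X *\<^sub>t T = t_one (t_rows T) (length T)"

definition t_invertible :: "tensor \<Rightarrow> bool" where
  "t_invertible T \<longleftrightarrow> (\<exists>X. is_t_inverse T X)"

definition t_inverse :: "tensor \<Rightarrow> tensor" where
  "t_inverse T = (THE X. is_t_inverse T X)"

definition is_t_group_inverse :: "tensor \<Rightarrow> tensor \<Rightarrow> bool" where
  "is_t_group_inverse T X \<longleftrightarrow>
     X \<in> carrier_tensor (t_rows T) (t_rows T) (length T) \<and>
     T *\<^sub>t X *\<^sub>t T = T \<and> X *\<^sub>t T *\<^sub>t X = X \<and> T *\<^sub>t X = X *\<^sub>t T"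

text \<open>The value is unspecified if no group inverse exists.\<close>

definition t_group_inverse :: "tensor \<Rightarrow> tensor" where
  "t_group_inverse T = (THE X. is_t_group_inverse T X)"

definition mat_rank :: "complex mat \<Rightarrow> nat" where
  "mat_rank A = vec_space.rank (dim_row A) A"

definition mat_ind :: "complex mat \<Rightarrow> nat" where
  "mat_ind A = (LEAST k. 0 < k \<and> mat_rank (A ^\<^sub>m k) = mat_rank (A ^\<^sub>m (k + 1)))"

definition t_ind :: "tensor \<Rightarrow> nat" where
  "t_ind T = mat_ind (bcirc T)"

definition kronecker :: "complex mat \<Rightarrow> complex mat \<Rightarrow> complex mat" where
  "kronecker A B = mat (dim_row A * dim_row B) (dim_col A * dim_col B)
     (\<lambda>(i, j). A $$ (i div dim_row B, j div dim_col B) * B $$ (i mod dim_row B, j mod dim_col B))"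

definition dft_mat :: "nat \<Rightarrow> complex mat" where
  "dft_mat p = mat p p (\<lambda>(j, k).
     1 / complex_of_real (sqrt (real p)) * exp (- 2 * complex_of_real pi * \<i> / of_nat p) ^ (j * k))"

definition dft_conj :: "nat \<Rightarrow> nat \<Rightarrow> complex mat list \<Rightarrow> complex mat" where
  "dft_conj n p Ds =
     kronecker (dft_mat p) (1\<^sub>m n) * diag_block_mat Ds * kronecker (mat_adjoint (dft_mat p)) (1\<^sub>m n)"

text \<open>A Jordan canonical form is determined only up to the order of its blocks, hence a relation.\<close>

definition is_jordan_form :: "complex mat \<Rightarrow> complex mat \<Rightarrow> bool" where
  "is_jordan_form B C \<longleftrightarrow> (\<exists>n_as. jordan_nf B n_as \<and> C = jordan_matrix n_as)"

text \<open>In \<open>similar_mat_wit B C Q P\<close> the matrix \<open>Q\<close> is the inverse of \<open>P\<close>, and \<open>B = Q * C * P\<close>.\<close>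

definition is_t_jordan_form :: "nat \<Rightarrow> nat \<Rightarrow> tensor \<Rightarrow> tensor \<Rightarrow> tensor \<Rightarrow> bool" where
  "is_t_jordan_form n p A P J \<longleftrightarrow>
     P \<in> carrier_tensor n n p \<and> J \<in> carrier_tensor n n p \<and>
     (\<exists>Bs Ps Cs.
        length Bs = p \<and> length Ps = p \<and> length Cs = p \<and>
        (\<forall>i<p. Bs ! i \<in> carrier_mat n n \<and> is_jordan_form (Bs ! i) (Cs ! i) \<and>
               (\<exists>Q. similar_mat_wit (Bs ! i) (Cs ! i) Q (Ps ! i))) \<and>
        bcirc A = dft_conj n p Bs \<and> bcirc P = dft_conj n p Ps \<and> bcirc J = dft_conj n p Cs)"

end

theory Submission
  imports Defs
begin

text \<open>With the T-product, the tensors of size \<open>n \<times> n \<times> p\<close> form a monoid, and the T-group inverse is the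
  group inverse of an element of a monoid, a notion that refers to the multiplication alone. It is
  therefore unique and is transported by conjugation: if \<open>x\<close> is the group inverse of \<open>a\<close>, then
  \<open>q\<inverse> x q\<close> is the group inverse of \<open>q\<inverse> a q\<close> (\<open>group_inverse_unique\<close>, \<open>group_inverse_conjugate\<close>).
  Applied to \<open>\<A> = \<P>\<inverse> * \<J> * \<P>\<close>, this gives the formula for the group inverse of \<open>\<A>\<close> as soon as \<open>\<J>\<close> has
  a group inverse, and since \<open>\<J> = \<P> * \<A> * \<P>\<inverse>\<close>, it is enough that \<open>\<A>\<close> has one.

  The existence for T-index \<open>1\<close> is where work is needed. Put \<open>M = bcirc \<A>\<close>. Index \<open>1\<close> means
  \<open>rank M\<^sup>2 = rank M\<close>, so the columns of \<open>M\<^sup>2\<close> contain a basis of the column space of \<open>M\<close>. With this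
  basis as the columns of \<open>B\<close>, one has \<open>M = B C\<close>; and \<open>B = M\<^sup>2 Z = B (C B) (C Z)\<close> gives
  \<open>(C B) (C Z) = 1\<close>, because \<open>B\<close> has independent columns. Hence \<open>C B\<close> is invertible
  (\<open>rank_square_factorization\<close>), and \<open>X = B (C B)\<^sup>-\<^sup>2 C\<close> is a group inverse of the matrix \<open>M\<close>.

  It remains to return from matrices to tensors. The candidate is the tensor \<open>x\<close> whose unfolding
  is the first block column of \<open>X\<close>. A product \<open>\<A> * \<U>\<close> unfolds to \<open>M\<close> times the unfolding of \<open>\<U>\<close>, so equations for \<open>X\<close>
  with factors \<open>M\<close> on the left pass to \<open>x\<close>, and the left inverse property \<open>X M\<^sup>2 = M\<close> becomes a
  cancellation rule for \<open>\<A>\<close>. These one-sided facts determine the group inverse in any monoid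
  (\<open>group_inverse_criterion\<close>). Both associativity of the T-product and this transfer rest on the
  multiplicativity of \<open>bcirc\<close> (\<open>bcirc_mult\<close>).\<close>

section \<open>Group inverses in monoids\<close>

context monoid
begin

definition group_inverse_of :: "'a \<Rightarrow> 'a \<Rightarrow> bool" where
  "group_inverse_of a x \<longleftrightarrow> x \<in> carrier G \<and> a \<otimes> x \<otimes> a = a \<and> x \<otimes> a \<otimes> x = x \<and> a \<otimes> x = x \<otimes> a"

text \<open>Two group inverses \<open>x\<close>, \<open>y\<close> of \<open>a\<close> define the same idempotent \<open>a x = y a\<close>, since each of the
  two products can absorb the other; then both \<open>x\<close> and \<open>y\<close> reduce to \<open>y a y\<close>.\<close>

lemma group_inverse_unique:
  assumes a: "a \<in> carrier G" and "group_inverse_of a x" "group_inverse_of a y"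
  shows "x = y"
proof -
  have x: "x \<in> carrier G" "a \<otimes> x \<otimes> a = a" "x \<otimes> a \<otimes> x = x" "a \<otimes> x = x \<otimes> a"
    and y: "y \<in> carrier G" "a \<otimes> y \<otimes> a = a" "y \<otimes> a \<otimes> y = y" "a \<otimes> y = y \<otimes> a"
    using assms(2,3) by (auto simp: group_inverse_of_def)
  have "a \<otimes> x = (a \<otimes> y) \<otimes> (a \<otimes> x)" using a x(1) y(1) y(2) by (metis m_assoc m_closed)
  also have "\<dots> = y \<otimes> (a \<otimes> x \<otimes> a)" using a x(1,4) y(1,4) by (metis m_assoc m_closed)
  finally have ax: "a \<otimes> x = y \<otimes> a" using x(2) by simp
  have "x = x \<otimes> (a \<otimes> y)" using a x y ax by (metis m_assoc)
  also have "\<dots> = (y \<otimes> a) \<otimes> y" using a x y ax by (metis m_assoc)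
  finally show ?thesis using y(3) by simp
qed

text \<open>Conjugation preserves products because the inner factors \<open>q \<otimes> q'\<close> cancel.\<close>

lemma group_inverse_conjugate:
  assumes c: "a \<in> carrier G" "q \<in> carrier G" "q' \<in> carrier G"
    and inv: "q \<otimes> q' = \<one>"
    and g: "group_inverse_of a x"
  shows "group_inverse_of (q' \<otimes> a \<otimes> q) (q' \<otimes> x \<otimes> q)"
proof -
  have x: "x \<in> carrier G" "a \<otimes> x \<otimes> a = a" "x \<otimes> a \<otimes> x = x" "a \<otimes> x = x \<otimes> a"
    using g by (auto simp: group_inverse_of_def)
  have conj_mult: "(q' \<otimes> s \<otimes> q) \<otimes> (q' \<otimes> t \<otimes> q) = q' \<otimes> (s \<otimes> t) \<otimes> q"
    if "s \<in> carrier G" "t \<in> carrier G" for s t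
  proof -
    have "(q' \<otimes> s \<otimes> q) \<otimes> (q' \<otimes> t \<otimes> q) = q' \<otimes> s \<otimes> (q \<otimes> q') \<otimes> t \<otimes> q"
      using c that by (simp add: m_assoc)
    then show ?thesis using c that inv by (simp add: m_assoc)
  qed
  show ?thesis
    using c x by (simp add: group_inverse_of_def conj_mult)
qed

text \<open>All hypotheses multiply by \<open>a\<close> on the left only. This makes them checkable for tensors, whose
  left multiplication by \<open>a\<close> is multiplication of the unfolding by one matrix. Each defining
  equation of the group inverse comes from an equation that begins with \<open>a \<otimes> a\<close> on both sides, where
  \<open>cancel\<close> removes one factor; the other one belongs to the equation, because \<open>x = a \<otimes> y\<close> begins
  with \<open>a\<close> as well.\<close>

lemma group_inverse_criterion:
  assumes a: "a \<in> carrier G" and xy: "x \<in> carrier G" "y \<in> carrier G"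
    and aax: "a \<otimes> a \<otimes> x = a" and x: "x = a \<otimes> y"
    and cancel: "\<And>u v. u \<in> carrier G \<Longrightarrow> v \<in> carrier G \<Longrightarrow>
                   a \<otimes> a \<otimes> u = a \<otimes> a \<otimes> v \<Longrightarrow> a \<otimes> u = a \<otimes> v"
  shows "group_inverse_of a x"
proof -
  have "a \<otimes> (x \<otimes> a) = a \<otimes> \<one>"
    using a xy aax by (intro cancel) (auto simp flip: m_assoc)
  then have axa: "a \<otimes> x \<otimes> a = a" using a xy by (simp add: m_assoc)
  have "a \<otimes> (y \<otimes> a) = a \<otimes> x"
  proof (rule cancel)
    have "a \<otimes> a \<otimes> (y \<otimes> a) = a \<otimes> (a \<otimes> y) \<otimes> a" using a xy by (simp add: m_assoc)
    then show "a \<otimes> a \<otimes> (y \<otimes> a) = a \<otimes> a \<otimes> x" using axa aax x by simp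
  qed (use a xy in auto)
  then have comm: "a \<otimes> x = x \<otimes> a" using a xy x by (simp add: m_assoc)
  have "a \<otimes> (x \<otimes> x) = a \<otimes> y"
  proof (rule cancel)
    have "a \<otimes> a \<otimes> (x \<otimes> x) = a \<otimes> x" using a xy aax by (simp flip: m_assoc)
    then show "a \<otimes> a \<otimes> (x \<otimes> x) = a \<otimes> a \<otimes> y" using a xy x by (simp add: m_assoc)
  qed (use a xy in auto)
  then have "x \<otimes> a \<otimes> x = x" using a xy comm x by (metis m_assoc)
  then show ?thesis using xy axa comm by (simp add: group_inverse_of_def)
qed

end

section \<open>Sums over block indices and cyclic differences\<close>

lemma mod_less_divisor_of_mult: "l < p * n \<Longrightarrow> l mod n < (n :: nat)"
  by (cases "n = 0") auto

lemma block_sum: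
  fixes f :: "nat \<Rightarrow> nat \<Rightarrow> 'a :: comm_monoid_add"
  shows "(\<Sum>l<p * n. f (l div n) (l mod n)) = (\<Sum>c<p. \<Sum>t<n. f c t)"
proof -
  have "(\<Sum>c<p. \<Sum>t<n. f c t) = (\<Sum>(c, t)\<in>{..<p} \<times> {..<n}. f c t)"
    by (rule sum.cartesian_product)
  also have "\<dots> = (\<Sum>l<p * n. f (l div n) (l mod n))"
    by (rule sum.reindex_bij_witness[of _ "\<lambda>l. (l div n, l mod n)" "\<lambda>(c, t). c * n + t"])
       (auto simp: less_mult_imp_div_less block_index_less intro: mod_less_divisor_of_mult)
  finally show ?thesis ..
qed

text \<open>The block indices of a block circulant matrix are natural numbers \<open>(p + i - j) mod p\<close>, with
  no truncation as \<open>j < p\<close>. Passing to integers turns identities between them into ring identities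
  modulo \<open>p\<close>.\<close>

lemma int_cyclic_diff:
  assumes "j < (p :: nat)"
  shows "int ((p + i - j) mod p) = (int i - int j) mod int p"
proof -
  have "int ((p + i - j) mod p) = (int p + (int i - int j)) mod int p"
    using assms by (simp add: zmod_int of_nat_diff algebra_simps)
  then show ?thesis by simp
qed

lemma cyclic_diff_diff:
  assumes "c < (p :: nat)" "j < p"
  shows "(p + (p + i - j) mod p - (p + c - j) mod p) mod p = (p + i - c) mod p"
proof -
  have "(p + c - j) mod p < p" using assms by simp
  then have "int ((p + (p + i - j) mod p - (p + c - j) mod p) mod p) = int ((p + i - c) mod p)"
    using assms by (simp add: int_cyclic_diff mod_simps)
  then show ?thesis by (simp only: of_nat_eq_iff)
qed

lemma cyclic_shift_sum:
  fixes g :: "nat \<Rightarrow> 'a :: comm_monoid_add"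
  assumes "j < p"
  shows "(\<Sum>c<p. g ((p + c - j) mod p)) = (\<Sum>c<p. g c)"
proof (rule sum.reindex_bij_witness[of _ "\<lambda>c. (c + j) mod p" "\<lambda>c. (p + c - j) mod p"])
  fix c assume c: "c \<in> {..<p}"
  then show "((p + c - j) mod p + j) mod p = c" 
    using assms by (simp add: mod_simps)
  have "int ((p + (c + j) mod p - j) mod p) = int c"
    using c by (subst int_cyclic_diff[OF assms]) (simp add: zmod_int mod_simps)
  then show "(p + (c + j) mod p - j) mod p = c" by (simp only: of_nat_eq_iff)
qed (use assms in auto)

section \<open>Matrices with the rank of their square\<close>

text \<open>As a conditional rewrite rule, this form brings products into right-nested shape: its
  conditions are discharged by the simplifier once the dimensions of the factors are known.\<close>

lemma mat_mult_assoc_dims: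
  fixes A B C :: "'a :: semiring_0 mat"
  assumes "dim_col A = dim_row B" "dim_col B = dim_row C"
  shows "A * B * C = A * (B * C)"
  using assms by (intro assoc_mult_mat[of _ "dim_row A" "dim_col A" _ "dim_col B" _ "dim_col C"]) auto

context vec_space
begin

lemma col_mem_col_space: "A \<in> carrier_mat n nc \<Longrightarrow> set (cols A) \<subseteq> col_space A"
  unfolding col_space_def using cols_dim[of A] by (intro in_own_span) auto

lemma col_space_mult_subset:
  assumes "A \<in> carrier_mat n m" "B \<in> carrier_mat m nc"
  shows "col_space (A * B) \<subseteq> col_space A"
proof
  fix y assume "y \<in> col_space (A * B)"
  then obtain x where "x \<in> carrier_vec nc" "A * B *\<^sub>v x = y"
    using col_space_eq[of "A * B" nc] assms by auto
  then have "B *\<^sub>v x \<in> carrier_vec m" "y = A *\<^sub>v (B *\<^sub>v x)" using assms by auto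
  then show "y \<in> col_space A" using col_space_eq[OF assms(1)] assms(1) by auto
qed

lemma factor_through_col_space:
  assumes A: "A \<in> carrier_mat n nc" and B: "B \<in> carrier_mat n r"
    and sub: "set (cols A) \<subseteq> col_space B"
  obtains C where "C \<in> carrier_mat r nc" "A = B * C"
proof -
  have "\<exists>x. x \<in> carrier_vec r \<and> B *\<^sub>v x = col A j" if "j < nc" for j
  proof -
    have "col A j \<in> set (cols A)" using that A by (auto simp: cols_def)
    then show ?thesis using sub col_space_eq[OF B] B by auto
  qed
  then obtain x where x: "\<And>j. j < nc \<Longrightarrow> x j \<in> carrier_vec r \<and> B *\<^sub>v x j = col A j"
    by metis
  define C where "C = mat_of_cols r (map x [0..<nc])"
  have C: "C \<in> carrier_mat r nc" by (rule carrier_matI) (simp_all add: C_def)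
  have "A = B * C"
  proof (rule mat_col_eqI)
    fix j assume "j < dim_col (B * C)"
    then have j: "j < nc" using C by simp
    then have "col C j = x j" using x by (simp add: C_def)
    then show "col A j = col (B * C) j" using x[OF j] col_mult2[OF B C j] by simp
  qed (use A B C in auto)
  with C show ?thesis by (rule that)
qed

text \<open>A maximal independent set of columns of \<open>A'\<close> has \<open>rank A'\<close> elements; lying in the column space
  of \<open>A\<close>, whose dimension is at most that, it must already be a basis of it.\<close>

lemma basis_of_col_space_from_cols:
  assumes A: "A \<in> carrier_mat n nc" and A': "A' \<in> carrier_mat n nc'"
    and sub: "col_space A' \<subseteq> col_space A" and rank: "rank A \<le> rank A'"
  obtains bs where "distinct bs" "set bs \<subseteq> set (cols A')" "lin_indpt (set bs)"
    "span (set bs) = col_space A"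
proof -
  obtain S where S: "finite S" "maximal S (\<lambda>T. T \<subseteq> set (cols A') \<and> lin_indpt T)"
    using maximal_exists_superset[of "set (cols A')" "\<lambda>T. T \<subseteq> set (cols A') \<and> lin_indpt T" "{}"]
    by (auto simp: lin_dep_def)
  have li: "S \<subseteq> set (cols A')" "lin_indpt S" using S(2) by (auto simp: maximal_def)
  have cA: "set (cols A) \<subseteq> carrier_vec n" using A cols_dim by blast
  have SA: "S \<subseteq> span (set (cols A))"
    using li(1) col_mem_col_space[OF A'] sub unfolding col_space_def by blast
  have sm: "submodule class_ring (span (set (cols A))) V"
    using cA by (intro span_is_submodule) auto
  interpret W: vectorspace class_ring "span_vs (set (cols A))"
    using cA by (intro subspace_is_vs span_is_subspace) auto
  have "W.basis S"
  proof (rule W.dim_li_is_basis)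
    show "W.fin_dim" by (rule fin_dim_span_cols[OF A])
    show "W.lin_indpt S" using span_li_not_depend(2)[OF SA sm] li(2) by simp
    show "W.dim \<le> card S" using rank rank_card_indpt[OF A' S(2)] by (simp add: rank_def)
  qed (use S SA in auto)
  then have "W.span S = span (set (cols A))" by (simp add: W.basis_def)
  then have "span S = col_space A"
    using span_li_not_depend(1)[OF SA sm] by (simp add: col_space_def)
  moreover obtain bs where "distinct bs" "set bs = S"
    using finite_distinct_list[OF S(1)] by blast
  ultimately show ?thesis using that li by metis
qed

text \<open>If the rank grew, the columns of the product would contain a basis of the column space
  of \<open>A\<close>, so both column spaces, and with them both ranks, would agree.\<close>

lemma rank_mult_le:
  assumes A: "A \<in> carrier_mat n m" and B: "B \<in> carrier_mat m nc"
  shows "rank (A * B) \<le> rank A"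
proof (rule ccontr)
  assume "\<not> ?thesis"
  then have less: "rank A < rank (A * B)" by simp
  have AB: "A * B \<in> carrier_mat n nc" using assms by simp
  obtain bs where bs: "distinct bs" "set bs \<subseteq> set (cols (A * B))" "lin_indpt (set bs)"
      "span (set bs) = col_space A"
    using basis_of_col_space_from_cols[OF A AB col_space_mult_subset[OF A B]] less by auto
  have "span (set (cols (A * B))) \<subseteq> span (set bs)"
    using bs(4) col_space_mult_subset[OF A B] by (simp add: col_space_def)
  moreover have "span (set bs) \<subseteq> span (set (cols (A * B)))"
    by (rule span_is_monotone[OF bs(2)])
  ultimately have "rank (A * B) = rank A"
    using bs(4) by (simp add: rank_def col_space_def)
  with less show False by simp
qed

lemma lin_indpt_cols_cancel:
  assumes B: "B \<in> carrier_mat n r" and d: "distinct (cols B)" and li: "lin_indpt (set (cols B))"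
    and C: "C \<in> carrier_mat r nc" and C': "C' \<in> carrier_mat r nc" and eq: "B * C = B * C'"
  shows "C = C'"
proof (rule mat_col_eqI)
  fix j assume "j < dim_col C'"
  then have j: "j < nc" using C' by simp
  have cols: "col C j \<in> carrier_vec r" "col C' j \<in> carrier_vec r"
    using col_carrier_vec[OF j] C C' by auto
  then have v: "col C j - col C' j \<in> carrier_vec r" by simp
  have "B *\<^sub>v col C j = B *\<^sub>v col C' j"
    using arg_cong[OF eq, of "\<lambda>X. col X j"] unfolding col_mult2[OF B C j] col_mult2[OF B C' j] .
  then have "B *\<^sub>v (col C j - col C' j) = 0\<^sub>v n"
    using mult_minus_distrib_mat_vec[OF B cols] mult_mat_vec_carrier[OF B cols(2)] by simp
  then have eq0: "col C j - col C' j = 0\<^sub>v r" using lin_depI[OF B v _ _ d] li by argo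
  show "col C j = col C' j"
  proof (rule eq_vecI)
    fix i assume "i < dim_vec (col C' j)"
    then have i: "i < r" using C' by simp
    then have "(col C j - col C' j) $ i = 0" by (simp add: eq0)
    then show "col C j $ i = col C' j $ i"
      using i cols C' by (simp add: index_minus_vec(1) carrier_vecD del: index_col)
  qed (use C C' in simp)
qed (use C C' in auto)

text \<open>A full rank factorization \<open>M = B C\<close> in which the columns of \<open>B\<close> are chosen among those
  of \<open>M * M\<close>. This choice makes \<open>C * B\<close> invertible: \<open>B\<close> factors through \<open>M * M = B (C B) C\<close>, and
  cancelling \<open>B\<close> on the left leaves a right inverse of the square matrix \<open>C * B\<close>.\<close>

lemma rank_square_factorization:
  assumes M: "M \<in> carrier_mat n n" and rank: "rank (M * M) = rank M"
  obtains r B C D where "B \<in> carrier_mat n r" "C \<in> carrier_mat r n" "D \<in> carrier_mat r r"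
    "M = B * C" "C * B * D = 1\<^sub>m r" "D * (C * B) = 1\<^sub>m r"
proof -
  have MM: "M * M \<in> carrier_mat n n" using M by simp
  obtain bs where bs: "distinct bs" "set bs \<subseteq> set (cols (M * M))" "lin_indpt (set bs)"
      "span (set bs) = col_space M"
    using basis_of_col_space_from_cols[OF M MM col_space_mult_subset[OF M M]] rank by auto
  define r where "r = length bs"
  define B where "B = mat_of_cols n bs"
  have B: "B \<in> carrier_mat n r" by (simp add: B_def r_def)
  have "set bs \<subseteq> carrier_vec n" using bs(2) MM cols_dim by blast
  then have cB: "cols B = bs" by (simp add: B_def)
  have "set (cols M) \<subseteq> col_space B"
    using col_mem_col_space[OF M] bs(4) by (simp add: col_space_def cB)
  then obtain C where C: "C \<in> carrier_mat r n" "M = B * C"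
    by (rule factor_through_col_space[OF M B])
  have "set (cols B) \<subseteq> col_space (M * M)"
    using bs(2) col_mem_col_space[OF MM] cB by auto
  then obtain Z where Z: "Z \<in> carrier_mat n r" "B = M * M * Z"
    by (rule factor_through_col_space[OF B MM])
  define D where "D = C * Z"
  have D: "D \<in> carrier_mat r r" using C Z by (simp add: D_def)
  have CB: "C * B \<in> carrier_mat r r" using C(1) B by simp
  have "C * B * D = 1\<^sub>m r"
  proof (rule lin_indpt_cols_cancel[OF B])
    have "B * (C * B * D) = B * C * (B * C) * Z"
      using B C(1) Z(1) by (simp add: D_def mat_mult_assoc_dims)
    also have "\<dots> = B" using Z(2) C(2) by simp
    finally show "B * (C * B * D) = B * 1\<^sub>m r" using B by simp
  qed (use bs cB CB D in auto)
  moreover from this have "D * (C * B) = 1\<^sub>m r"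
    by (rule mat_mult_left_right_inverse[OF CB D])
  ultimately show ?thesis using that B C D by blast
qed

end

text \<open>The matrix \<open>X = B D\<^sup>2 C\<close> is the group inverse of \<open>M = B C\<close>, where \<open>D\<close> is the inverse of \<open>C B\<close>.
  The listed equations are the consequences that can be read on first block columns:
  two with factors \<open>M\<close> on the left, and one that cancels a factor \<open>M\<close>.\<close>

lemma matrix_group_inverse_exists:
  fixes M :: "'a :: field mat"
  assumes M: "M \<in> carrier_mat n n" and rank: "vec_space.rank n (M * M) = vec_space.rank n M"
  obtains X where "X \<in> carrier_mat n n" "M * (M * X) = M" "M * (X * X) = X" "X * (M * M) = M"
proof -
  obtain r B C D where c: "B \<in> carrier_mat n r" "C \<in> carrier_mat r n" "D \<in> carrier_mat r r"
    and eq: "M = B * C" "C * B * D = 1\<^sub>m r" "D * (C * B) = 1\<^sub>m r"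
    by (rule vec_space.rank_square_factorization[OF M rank])
  have CBD: "C * (B * (D * Y)) = Y" if "dim_row Y = r" for Y
  proof -
    have "C * (B * (D * Y)) = C * B * D * Y" using c that by (simp add: mat_mult_assoc_dims)
    also have "\<dots> = Y" unfolding eq(2) using that by (intro left_mult_one_mat') auto
    finally show ?thesis .
  qed
  have DCB: "D * (C * (B * Y)) = Y" if "dim_row Y = r" for Y
  proof -
    have "D * (C * (B * Y)) = D * (C * B) * Y" using c that by (simp add: mat_mult_assoc_dims)
    also have "\<dots> = Y" unfolding eq(3) using that by (intro left_mult_one_mat') auto
    finally show ?thesis .
  qed
  show ?thesis
  proof (rule that[of "B * (D * (D * C))"])
    show "B * (D * (D * C)) \<in> carrier_mat n n" using c by auto
  qed (use c in \<open>simp_all add: eq(1) mat_mult_assoc_dims CBD DCB\<close>)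
qed

text \<open>The index is a least element, and its value says something about ranks only when the set of
  candidates is not empty. Ranks of successive powers never increase, so they cannot differ
  at every step.\<close>

lemma mat_rank_power_stabilizes:
  assumes M: "M \<in> carrier_mat n n"
  shows "\<exists>k>0. mat_rank (M ^\<^sub>m k) = mat_rank (M ^\<^sub>m (k + 1))"
proof (rule ccontr)
  assume contra: "\<not> ?thesis"
  define f where "f k = mat_rank (M ^\<^sub>m Suc k)" for k
  have f_less: "f (Suc k) < f k" for k
  proof -
    have c: "M ^\<^sub>m Suc k \<in> carrier_mat n n" by (rule pow_carrier_mat[OF M])
    have "f (Suc k) \<le> f k"
      using vec_space.rank_mult_le[OF c M] c M
      unfolding f_def mat_rank_def pow_mat.simps(2)[of M "Suc k"] by simp
    moreover have "f (Suc k) \<noteq> f k" using contra[simplified, rule_format, of "Suc k"] by (auto simp: f_def)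
    ultimately show ?thesis by simp
  qed
  have "f k + k \<le> f 0" for k
  proof (induction k)
    case (Suc k)
    then show ?case using f_less[of k] by simp
  qed simp
  from this[of "Suc (f 0)"] show False by simp
qed

lemma mat_ind_1_rank:
  assumes M: "M \<in> carrier_mat n n" and ind: "mat_ind M = 1"
  shows "vec_space.rank n (M * M) = vec_space.rank n M"
proof -
  have "mat_rank (M ^\<^sub>m mat_ind M) = mat_rank (M ^\<^sub>m (mat_ind M + 1))"
    using LeastI_ex[OF mat_rank_power_stabilizes[OF M]] unfolding mat_ind_def by blast
  then show ?thesis using M by (simp add: ind mat_rank_def)
qed

section \<open>The monoid of tensors\<close>

lemma bcirc_carrier:
  assumes "T \<in> carrier_tensor m n p" "0 < p"
  shows "bcirc T \<in> carrier_mat (p * m) (p * n)"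
  using t_dims[OF assms] by (simp add: bcirc_def)

lemma t_unfold_carrier:
  assumes "T \<in> carrier_tensor m n p" "0 < p"
  shows "t_unfold T \<in> carrier_mat (p * m) n"
  using t_dims[OF assms] by (simp add: t_unfold_def)

lemma bcirc_index:
  assumes "T \<in> carrier_tensor m n p" "0 < p" "i < p * m" "j < p * n"
  shows "bcirc T $$ (i, j) = T ! ((p + i div m - j div n) mod p) $$ (i mod m, j mod n)"
  using t_dims[OF assms(1,2)] assms(3,4) by (simp add: bcirc_def)

lemma t_unfold_index:
  assumes "T \<in> carrier_tensor m n p" "0 < p" "i < p * m" "j < n"
  shows "t_unfold T $$ (i, j) = T ! (i div m) $$ (i mod m, j)"
  using t_dims[OF assms(1,2)] assms(3,4) by (simp add: t_unfold_def)

lemma t_unfold_inject: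
  assumes "S \<in> carrier_tensor m n p" "T \<in> carrier_tensor m n p" "0 < p" "t_unfold S = t_unfold T"
  shows "S = T"
  using assms t_fold_unfold by metis

context
  fixes m n q p :: nat and S T :: tensor
  assumes S: "S \<in> carrier_tensor m n p" and T: "T \<in> carrier_tensor n q p" and p: "0 < p"
begin

lemma t_mult_closed: "S *\<^sub>t T \<in> carrier_tensor m q p"
  and t_unfold_mult: "t_unfold (S *\<^sub>t T) = bcirc S * t_unfold T"
proof -
  have "bcirc S * t_unfold T \<in> carrier_mat (p * m) q"
    using bcirc_carrier[OF S p] t_unfold_carrier[OF T p] by simp
  from t_unfold_fold[OF this p]
  show "S *\<^sub>t T \<in> carrier_tensor m q p" "t_unfold (S *\<^sub>t T) = bcirc S * t_unfold T"
    using t_dims[OF S p] by (simp_all add: t_mult_def)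
qed

lemma t_mult_index:
  assumes k: "k < p" and i: "i < m" and j: "j < q"
  shows "(S *\<^sub>t T) ! k $$ (i, j) = (\<Sum>c<p. \<Sum>t<n. S ! ((p + k - c) mod p) $$ (i, t) * T ! c $$ (t, j))"
proof -
  have ki: "k * m + i < p * m" using k i by (rule block_index_less)
  have "(S *\<^sub>t T) ! k $$ (i, j) = t_unfold (S *\<^sub>t T) $$ (k * m + i, j)"
    using t_unfold_index[OF t_mult_closed p ki j] i by simp
  also have "\<dots> = (\<Sum>l<p * n. bcirc S $$ (k * m + i, l) * t_unfold T $$ (l, j))"
    unfolding t_unfold_mult
    using bcirc_carrier[OF S p] t_unfold_carrier[OF T p] ki j
    by (simp add: scalar_prod_def atLeast0LessThan)
  also have "\<dots> = (\<Sum>l<p * n. S ! ((p + k - l div n) mod p) $$ (i, l mod n) * T ! (l div n) $$ (l mod n, j))"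
    using bcirc_index[OF S p ki] t_unfold_index[OF T p _ j] i by (intro sum.cong) auto
  also have "\<dots> = (\<Sum>c<p. \<Sum>t<n. S ! ((p + k - c) mod p) $$ (i, t) * T ! c $$ (t, j))"
    by (rule block_sum)
  finally show ?thesis .
qed

text \<open>Block \<open>(a, b)\<close> of the product of the two block circulant matrices is
  \<open>\<Sum>\<^sub>c S\<^sub>a\<^sub>-\<^sub>c T\<^sub>c\<^sub>-\<^sub>b\<close> with slice indices modulo \<open>p\<close>. The substitution of \<open>c\<close> for \<open>c - b\<close> turns this sum
  into \<open>\<Sum>\<^sub>c S\<^sub>(\<^sub>a\<^sub>-\<^sub>b\<^sub>)\<^sub>-\<^sub>c T\<^sub>c\<close>, which is slice \<open>a - b\<close> of the T-product.\<close>

lemma bcirc_mult: "bcirc (S *\<^sub>t T) = bcirc S * bcirc T"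
proof (rule eq_matI)
  note bS = bcirc_carrier[OF S p] and bT = bcirc_carrier[OF T p]
  fix i j assume "i < dim_row (bcirc S * bcirc T)" "j < dim_col (bcirc S * bcirc T)"
  then have i: "i < p * m" and j: "j < p * q" using bS bT by auto
  define a b where "a = i div m" and "b = j div q"
  have ab: "a < p" "b < p" "i mod m < m" "j mod q < q"
    using i j by (auto simp: a_def b_def less_mult_imp_div_less intro: mod_less_divisor_of_mult)
  let ?g = "\<lambda>d c. \<Sum>t<n. S ! d $$ (i mod m, t) * T ! c $$ (t, j mod q)"
  have "(bcirc S * bcirc T) $$ (i, j) = (\<Sum>l<p * n. bcirc S $$ (i, l) * bcirc T $$ (l, j))"
    using bS bT i j by (simp add: scalar_prod_def atLeast0LessThan)
  also have "\<dots> = (\<Sum>l<p * n. S ! ((p + a - l div n) mod p) $$ (i mod m, l mod n) *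
                       T ! ((p + l div n - b) mod p) $$ (l mod n, j mod q))"
    using bcirc_index[OF S p i] bcirc_index[OF T p _ j] by (intro sum.cong) (auto simp: a_def b_def)
  also have "\<dots> = (\<Sum>c<p. ?g ((p + a - c) mod p) ((p + c - b) mod p))"
    by (rule block_sum)
  also have "\<dots> = (\<Sum>c<p. ?g ((p + (p + a - b) mod p - (p + c - b) mod p) mod p) ((p + c - b) mod p))"
    using ab by (intro sum.cong) (auto simp: cyclic_diff_diff)
  also have "\<dots> = (\<Sum>c<p. ?g ((p + (p + a - b) mod p - c) mod p) c)"
    using ab(2) by (rule cyclic_shift_sum)
  also have "\<dots> = (S *\<^sub>t T) ! ((p + a - b) mod p) $$ (i mod m, j mod q)"
    using ab p by (intro t_mult_index[symmetric]) auto
  also have "\<dots> = bcirc (S *\<^sub>t T) $$ (i, j)"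
    using bcirc_index[OF t_mult_closed p i j] by (simp add: a_def b_def)
  finally show "bcirc (S *\<^sub>t T) $$ (i, j) = (bcirc S * bcirc T) $$ (i, j)" ..
qed (use bcirc_carrier[OF S p] bcirc_carrier[OF T p] bcirc_carrier[OF t_mult_closed p] in auto)

end

lemma t_one_closed: "t_one n p \<in> carrier_tensor n n p"
  by (auto simp: t_one_def carrier_tensor_def)

lemma t_unfold_one_index:
  assumes "0 < p" "i < p * n" "j < n"
  shows "t_unfold (t_one n p) $$ (i, j) = (if i = j then 1 else 0)"
proof -
  have "i div n < p" "i mod n < n"
    using assms by (auto simp: less_mult_imp_div_less)
  moreover have "i = j \<longleftrightarrow> i div n = 0 \<and> i mod n = j"
    using assms(3) by (metis div_less mod_less mult_0_right add_0 mult_div_mod_eq)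
  ultimately show ?thesis
    using assms t_unfold_index[OF t_one_closed assms] by (auto simp: t_one_def)
qed

text \<open>The unfolded identity tensor is an identity matrix above zero blocks, so multiplication by it
  selects the first block column, which consists of the slices in their order.\<close>

lemma bcirc_first_block_column:
  assumes T: "T \<in> carrier_tensor m n p" and p: "0 < p"
  shows "bcirc T * t_unfold (t_one n p) = t_unfold T"
proof (rule eq_matI)
  note bT = bcirc_carrier[OF T p] and uT = t_unfold_carrier[OF T p]
    and uI = t_unfold_carrier[OF t_one_closed p, of n]
  fix i j assume "i < dim_row (t_unfold T)" "j < dim_col (t_unfold T)"
  then have i: "i < p * m" and j: "j < n" using uT by auto
  have j': "j < p * n" using block_index_less[OF p j] by simp
  have "(bcirc T * t_unfold (t_one n p)) $$ (i, j) =
        (\<Sum>l<p * n. bcirc T $$ (i, l) * t_unfold (t_one n p) $$ (l, j))"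
    using bT uI i j by (simp add: scalar_prod_def atLeast0LessThan)
  also have "\<dots> = (\<Sum>l<p * n. if l = j then bcirc T $$ (i, l) else 0)"
    using t_unfold_one_index[OF p _ j] by (intro sum.cong) auto
  also have "\<dots> = bcirc T $$ (i, j)" using j' by simp
  also have "\<dots> = t_unfold T $$ (i, j)"
    using bcirc_index[OF T p i j'] t_unfold_index[OF T p i j] j i
    by (simp add: less_mult_imp_div_less)
  finally show "(bcirc T * t_unfold (t_one n p)) $$ (i, j) = t_unfold T $$ (i, j)" .
qed (use bcirc_carrier[OF T p] t_unfold_carrier[OF T p] t_unfold_carrier[OF t_one_closed p, of n] in auto)

lemma cyclic_diff_eq_0_iff:
  assumes "a < p" "b < (p :: nat)"
  shows "(p + a - b) mod p = 0 \<longleftrightarrow> a = b"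
proof (cases "b \<le> a")
  case True
  then have "(p + a - b) mod p = a - b" using assms by (simp add: mod_if)
  then show ?thesis using True by auto
qed (use assms in auto)

lemma bcirc_one:
  assumes p: "0 < p"
  shows "bcirc (t_one n p) = 1\<^sub>m (p * n)"
proof (rule eq_matI)
  fix i j assume "i < dim_row (1\<^sub>m (p * n) :: complex mat)" "j < dim_col (1\<^sub>m (p * n) :: complex mat)"
  then have ij: "i < p * n" "j < p * n" by auto
  then have "i div n < p" "j div n < p" "i mod n < n" "j mod n < n"
    by (auto simp: less_mult_imp_div_less intro: mod_less_divisor_of_mult)
  moreover have "i = j \<longleftrightarrow> i div n = j div n \<and> i mod n = j mod n"
    by (metis mult_div_mod_eq)
  ultimately show "bcirc (t_one n p) $$ (i, j) = 1\<^sub>m (p * n) $$ (i, j)"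
    using ij bcirc_index[OF t_one_closed p ij] p cyclic_diff_eq_0_iff[of "i div n" p "j div n"]
    by (auto simp: t_one_def)
qed (use bcirc_carrier[OF t_one_closed p, of n] in auto)

definition tensor_monoid :: "nat \<Rightarrow> nat \<Rightarrow> tensor monoid" where
  "tensor_monoid n p = \<lparr>carrier = carrier_tensor n n p, monoid.mult = (*\<^sub>t), one = t_one n p\<rparr>"

lemma tensor_monoid_simps [simp]:
  "carrier (tensor_monoid n p) = carrier_tensor n n p"
  "monoid.mult (tensor_monoid n p) = (*\<^sub>t)"
  "one (tensor_monoid n p) = t_one n p"
  by (simp_all add: tensor_monoid_def)

lemma monoid_tensor_monoid:
  assumes p: "0 < p"
  shows "monoid (tensor_monoid n p)"
proof (rule monoidI; simp)
  fix x y z assume c: "x \<in> carrier_tensor n n p" "y \<in> carrier_tensor n n p" "z \<in> carrier_tensor n n p"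
  show "x *\<^sub>t y *\<^sub>t z = x *\<^sub>t (y *\<^sub>t z)"
  proof (rule t_unfold_inject[OF _ _ p])
    show "t_unfold (x *\<^sub>t y *\<^sub>t z) = t_unfold (x *\<^sub>t (y *\<^sub>t z))"
      using bcirc_carrier[OF c(1) p] bcirc_carrier[OF c(2) p] t_unfold_carrier[OF c(3) p]
      by (simp add: t_unfold_mult[OF t_mult_closed[OF c(1,2) p] c(3) p] bcirc_mult[OF c(1,2) p]
          t_unfold_mult[OF c(1) t_mult_closed[OF c(2,3) p] p] t_unfold_mult[OF c(2,3) p]
          mat_mult_assoc_dims)
  qed (use c p in \<open>auto intro!: t_mult_closed\<close>)
next
  fix x assume c: "x \<in> carrier_tensor n n p"
  show "t_one n p *\<^sub>t x = x"
    using t_unfold_mult[OF t_one_closed c p] t_unfold_carrier[OF c p]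
    by (intro t_unfold_inject[OF _ c p] t_mult_closed[OF t_one_closed c p])
       (simp add: bcirc_one[OF p])
  show "x *\<^sub>t t_one n p = x"
    using t_unfold_mult[OF c t_one_closed p] bcirc_first_block_column[OF c p]
    by (intro t_unfold_inject[OF _ c p] t_mult_closed[OF c t_one_closed p]) simp
qed (use p in \<open>auto intro!: t_mult_closed t_one_closed\<close>)

section \<open>T-group inverses\<close>

lemma is_t_group_inverse_iff:
  assumes "A \<in> carrier_tensor n n p" "0 < p"
  shows "is_t_group_inverse A X \<longleftrightarrow> monoid.group_inverse_of (tensor_monoid n p) A X"
  using t_dims[OF assms]
  by (simp add: is_t_group_inverse_def monoid.group_inverse_of_def[OF monoid_tensor_monoid[OF assms(2)]])

text \<open>The tensors \<open>x\<close> and \<open>y\<close> are cut from the first block columns of \<open>X\<close> and \<open>X\<^sup>2\<close>, with \<open>X\<close> a group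
  inverse of the matrix \<open>bcirc A\<close>. The equations \<open>M\<^sup>2 X = M\<close>, \<open>X = M X\<^sup>2\<close> and \<open>X M\<^sup>2 = M\<close> provide,
  in this order, the three hypotheses of \<open>group_inverse_criterion\<close>.\<close>

lemma t_group_inverse_exists:
  assumes A: "A \<in> carrier_tensor n n p" and p: "0 < p" and ind: "t_ind A = 1"
  shows "\<exists>X. is_t_group_inverse A X"
proof -
  interpret monoid "tensor_monoid n p" by (rule monoid_tensor_monoid[OF p])
  define M where "M = bcirc A"
  define E where "E = t_unfold (t_one n p)"
  have M: "M \<in> carrier_mat (p * n) (p * n)" unfolding M_def by (rule bcirc_carrier[OF A p])
  have E: "E \<in> carrier_mat (p * n) n" unfolding E_def by (rule t_unfold_carrier[OF t_one_closed p])
  obtain X where X: "X \<in> carrier_mat (p * n) (p * n)"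
    and MMX: "M * (M * X) = M" and MXX: "M * (X * X) = X" and XMM: "X * (M * M) = M"
    using matrix_group_inverse_exists[OF M mat_ind_1_rank[OF M]] ind unfolding t_ind_def M_def by blast
  define x where "x = t_fold n p (X * E)"
  define y where "y = t_fold n p (X * X * E)"
  have x: "x \<in> carrier_tensor n n p" "t_unfold x = X * E"
    unfolding x_def using X E by (auto intro!: t_unfold_fold[OF _ p])
  have y: "y \<in> carrier_tensor n n p" "t_unfold y = X * X * E"
    unfolding y_def using X E by (auto intro!: t_unfold_fold[OF _ p])
  have AA: "A *\<^sub>t A \<in> carrier_tensor n n p" by (rule t_mult_closed[OF A A p])
  have unfold_A: "t_unfold (A *\<^sub>t u) = M * t_unfold u"
    and unfold_AA: "t_unfold (A *\<^sub>t A *\<^sub>t u) = M * M * t_unfold u"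
    if "u \<in> carrier_tensor n n p" for u
    using t_unfold_mult[OF A that p] t_unfold_mult[OF AA that p] bcirc_mult[OF A A p]
    by (simp_all add: M_def)
  have "group_inverse_of A x"
  proof (rule group_inverse_criterion)
    have "t_unfold (A *\<^sub>t A *\<^sub>t x) = M * (M * X) * E"
      unfolding unfold_AA[OF x(1)] x(2) using M X E by (simp add: mat_mult_assoc_dims)
    also have "\<dots> = t_unfold A"
      unfolding MMX unfolding M_def E_def by (rule bcirc_first_block_column[OF A p])
    finally have "A *\<^sub>t A *\<^sub>t x = A"
      by (rule t_unfold_inject[OF t_mult_closed[OF AA x(1) p] A p])
    then show "A \<otimes>\<^bsub>tensor_monoid n p\<^esub> A \<otimes>\<^bsub>tensor_monoid n p\<^esub> x = A" by simp
    have "t_unfold (A *\<^sub>t y) = M * (X * X) * E"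
      unfolding unfold_A[OF y(1)] y(2) using M X E by (simp add: mat_mult_assoc_dims)
    then have "t_unfold x = t_unfold (A *\<^sub>t y)" by (simp add: MXX x(2))
    then have "x = A *\<^sub>t y" by (rule t_unfold_inject[OF x(1) t_mult_closed[OF A y(1) p] p])
    then show "x = A \<otimes>\<^bsub>tensor_monoid n p\<^esub> y" by simp
  next
    fix u v assume "u \<in> carrier (tensor_monoid n p)" "v \<in> carrier (tensor_monoid n p)"
      and eq: "A \<otimes>\<^bsub>tensor_monoid n p\<^esub> A \<otimes>\<^bsub>tensor_monoid n p\<^esub> u =
               A \<otimes>\<^bsub>tensor_monoid n p\<^esub> A \<otimes>\<^bsub>tensor_monoid n p\<^esub> v"
    then have uv: "u \<in> carrier_tensor n n p" "v \<in> carrier_tensor n n p" by auto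
    have X_unfold: "X * t_unfold (A *\<^sub>t A *\<^sub>t w) = t_unfold (A *\<^sub>t w)"
      if w: "w \<in> carrier_tensor n n p" for w
    proof -
      have "X * t_unfold (A *\<^sub>t A *\<^sub>t w) = X * (M * M) * t_unfold w"
        unfolding unfold_AA[OF w] using M X t_unfold_carrier[OF w p]
        by (simp add: mat_mult_assoc_dims)
      then show ?thesis by (simp add: XMM unfold_A[OF w])
    qed
    have "t_unfold (A *\<^sub>t u) = t_unfold (A *\<^sub>t v)"
      using X_unfold[OF uv(1)] X_unfold[OF uv(2)] eq by simp
    then have "A *\<^sub>t u = A *\<^sub>t v"
      by (rule t_unfold_inject[OF t_mult_closed[OF A uv(1) p] t_mult_closed[OF A uv(2) p] p])
    then show "A \<otimes>\<^bsub>tensor_monoid n p\<^esub> u = A \<otimes>\<^bsub>tensor_monoid n p\<^esub> v" by simp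
  qed (use A x y in auto)
  then show ?thesis using is_t_group_inverse_iff[OF A p] by blast
qed

lemma t_group_inverse_equality:
  assumes A: "A \<in> carrier_tensor n n p" and p: "0 < p" and X: "is_t_group_inverse A X"
  shows "\<exists>!Y. is_t_group_inverse A Y" "t_group_inverse A = X"
proof -
  interpret monoid "tensor_monoid n p" by (rule monoid_tensor_monoid[OF p])
  have unique: "Y = X" if "is_t_group_inverse A Y" for Y
    using group_inverse_unique[of A Y X] A X that by (simp add: is_t_group_inverse_iff[OF A p])
  show "\<exists>!Y. is_t_group_inverse A Y" using X unique by blast
  show "t_group_inverse A = X" unfolding t_group_inverse_def using X unique by (rule the_equality)
qed

lemma is_t_inverse_t_inverse:
  assumes P: "P \<in> carrier_tensor n n p" and p: "0 < p" and inv: "t_invertible P"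
  shows "is_t_inverse P (t_inverse P)"
proof -
  interpret monoid "tensor_monoid n p" by (rule monoid_tensor_monoid[OF p])
  have "Y = Z" if "is_t_inverse P Y" "is_t_inverse P Z" for Y Z
    using inv_unique[of Y P Z] that P t_dims[OF P p] by (simp add: is_t_inverse_def)
  then have "\<exists>!Y. is_t_inverse P Y" using inv unfolding t_invertible_def by blast
  then show ?thesis unfolding t_inverse_def by (rule theI')
qed

theorem theorem14:
  fixes n p :: nat and A P J :: tensor
  assumes "0 < n" and "0 < p"
    and "A \<in> carrier_tensor n n p"
    and "t_ind A = 1"
    and "is_t_jordan_form n p A P J"
    and "t_invertible P"
    and "A = t_inverse P *\<^sub>t J *\<^sub>t P"
  shows "(\<exists>!X. is_t_group_inverse J X) \<and>
         (\<exists>!X. is_t_group_inverse A X) \<and>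
         t_group_inverse A = t_inverse P *\<^sub>t t_group_inverse J *\<^sub>t P"
proof -
  note p = \<open>0 < p\<close> and A = \<open>A \<in> carrier_tensor n n p\<close>
  interpret monoid "tensor_monoid n p" by (rule monoid_tensor_monoid[OF p])
  define Q where "Q = t_inverse P"
  have P: "P \<in> carrier_tensor n n p" and J: "J \<in> carrier_tensor n n p"
    using assms(5) by (auto simp: is_t_jordan_form_def)
  have Q: "Q \<in> carrier_tensor n n p" and PQ: "P *\<^sub>t Q = t_one n p" and QP: "Q *\<^sub>t P = t_one n p"
    using is_t_inverse_t_inverse[OF P p assms(6)] t_dims[OF P p]
    by (auto simp: is_t_inverse_def Q_def)
  have A_eq: "A = Q *\<^sub>t J *\<^sub>t P" using assms(7) by (simp add: Q_def)
  have "P *\<^sub>t A *\<^sub>t Q = (P *\<^sub>t Q) *\<^sub>t J *\<^sub>t (P *\<^sub>t Q)"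
    unfolding A_eq using P Q J by (simp add: m_assoc[simplified] m_closed[simplified])
  then have J_eq: "P *\<^sub>t A *\<^sub>t Q = J"
    using J by (simp add: PQ l_one[simplified] r_one[simplified])
  obtain X where X: "is_t_group_inverse A X"
    using t_group_inverse_exists[OF A p assms(4)] by blast
  have "group_inverse_of J (P *\<^sub>t X *\<^sub>t Q)"
    using group_inverse_conjugate[of A Q P X] X A P Q QP
    unfolding is_t_group_inverse_iff[OF A p] by (simp add: J_eq)
  then have "is_t_group_inverse J (P *\<^sub>t X *\<^sub>t Q)"
    unfolding is_t_group_inverse_iff[OF J p] .
  note J_inv = t_group_inverse_equality[OF J p this] this
  have "group_inverse_of J (t_group_inverse J)"
    using J_inv(2,3) unfolding is_t_group_inverse_iff[OF J p] by simp
  then have "group_inverse_of A (Q *\<^sub>t t_group_inverse J *\<^sub>t P)"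
    using group_inverse_conjugate[of J P Q "t_group_inverse J"] J P Q PQ
    by (simp add: A_eq[symmetric])
  then have "is_t_group_inverse A (Q *\<^sub>t t_group_inverse J *\<^sub>t P)"
    unfolding is_t_group_inverse_iff[OF A p] .
  from t_group_inverse_equality[OF A p this] J_inv(1) show ?thesis by (simp add: Q_def)
qed

end
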